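(* Let $X$ be an infinite dimensional separable Banach space with a $1$-unconditional basis. Let $Y$ be an infinite dimensional separable Banach space with a normalized $1$-unconditional basis $(f_n)_{n\geq 0}$ such that the associated backward shift operator ($f_0\mapsto 0$, $f_n\mapsto f_{n-1}$ for $n\geq 1$) is continuous on $Y$. Let $Z=\bigoplus_Y X$ (formed with the basis $(f_n)$). Then for every $\varepsilon\in(0,1)$ there exists an operator $T\in\mathcal L(Z)$ such that $T$ is not $\delta$-hypercyclic for any $\delta\in(0,\varepsilon)$, and $T$ is $\delta$-hypercyclic for every $\delta\in(\varepsilon,1)$.
   Context: All spaces are over $\mathbb C$; $\mathcal L(X)$ denotes the bounded linear operators on $X$, and operator means bounded linear operator. $\delta$-hypercyclicity: for $\delta\in(0,1)$, a vector $x\in X$ is a $\delta$-hypercyclic vector for $T\in\mathcal L(X)$ if for every non-zero $y\in X$ there exists $n\in\mathbb N$ with $\|T^n x-y\|\leq\delta\|y\|$. The operator $T$ is $\delta$-hypercyclic if it admits a $\delta$-hypercyclic vector. A sequence $(e_n)_{n\geq 0}$ is a basis of $X$ if every $x\in X$ can be written uniquely as a convergent series $x=\sum_{n\geq 0}x_n e_n$ with scalars $x_n$. It is normalized if $\|e_n\|=1$ for all $n$. A basis is $C$-unconditional ($C\geq 1$) if for all $N\geq 0$ and all scalars $(a_n)_{n=0,\dots,N}$, $(b_n)_{n=0,\dots,N}$ with $|b_n|\leq|a_n|$ for all $n$, one has $\left\|\sum_{n=0}^N b_ne_n\right\|\leq C\left\|\sum_{n=0}^N a_ne_n\right\|$.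 For Banach spaces $X,Y$ and a $1$-unconditional basis $(f_n)_{n\ge 0}$ of $Y$, $\bigoplus_Y X$ is the Banach space $\left\{(x_n)\in X^{\mathbb N}:\ \sum_{n=0}^{+\infty}\|x_n\|_X f_n\in Y\right\}$ (i.e. the series converges in $Y$) with norm $\|(x_n)\|=\left\|\sum_{n=0}^{+\infty}\|x_n\|_Xf_n\right\|_Y$. *)

theory Defs
  imports "HOL-Analysis.Analysis" "HOL-Library.Function_Algebras"
begin

section \<open>Complex normed spaces\<close>

text \<open>
  The distribution only has type classes for real normed spaces. A complex space is a real one
  with a complex scalar multiplication extending the real one.
\<close>

class complex_vector = real_vector +
  fixes scaleC :: "complex \<Rightarrow> 'a \<Rightarrow> 'a" (infixr "*\<^sub>C" 75)
  assumes scaleC_add_right: "c *\<^sub>C (x + y) = c *\<^sub>C x + c *\<^sub>C y"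
    and scaleC_add_left: "(c + d) *\<^sub>C x = c *\<^sub>C x + d *\<^sub>C x"
    and scaleC_scaleC: "c *\<^sub>C d *\<^sub>C x = (c * d) *\<^sub>C x"
    and scaleC_of_real: "complex_of_real r *\<^sub>C x = r *\<^sub>R x"

class complex_normed_vector = complex_vector + real_normed_vector +
  assumes norm_scaleC: "norm (c *\<^sub>C x) = cmod c * norm x"

class complex_banach = complex_normed_vector + complete_space

global_interpretation complex_vector:
  vector_space "scaleC :: complex \<Rightarrow> 'a \<Rightarrow> 'a::complex_vector"
proof
  show "1 *\<^sub>C x = x" for x :: 'a
    using scaleC_of_real[of 1 x] by simp
qed (simp_all add: scaleC_add_right scaleC_add_left scaleC_scaleC)

instance complex_banach \<subseteq> banach ..

definition infinite_dimensional :: "'a::complex_vector itself \<Rightarrow> bool" where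
  "infinite_dimensional _ \<longleftrightarrow>
     \<not> (\<exists>B :: 'a set. finite B \<and> complex_vector.span B = UNIV)"

instantiation complex :: complex_banach
begin
definition scaleC_complex :: "complex \<Rightarrow> complex \<Rightarrow> complex" where
  "scaleC_complex c z = c * z"
instance
  by standard (simp_all add: scaleC_complex_def algebra_simps norm_mult scaleR_conv_of_real)
end

instantiation "fun" :: (type, complex_vector) complex_vector
begin
definition scaleR_fun :: "real \<Rightarrow> ('a \<Rightarrow> 'b) \<Rightarrow> 'a \<Rightarrow> 'b" where
  "scaleR_fun r x = (\<lambda>n. r *\<^sub>R x n)"
definition scaleC_fun :: "complex \<Rightarrow> ('a \<Rightarrow> 'b) \<Rightarrow> 'a \<Rightarrow> 'b" where
  "scaleC_fun c x = (\<lambda>n. c *\<^sub>C x n)"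
instance
  by standard
    (simp_all add: scaleR_fun_def scaleC_fun_def fun_eq_iff scaleR_add_right scaleR_add_left
      scaleC_add_right scaleC_add_left scaleC_scaleC scaleC_of_real)
end


section \<open>Operators and hypercyclicity\<close>

text \<open>
  The direct sum below depends on a basis, hence on a term, so it cannot be a type. The notions
  for operators are therefore relative to a complex linear subspace \<open>S\<close> of the ambient type,
  normed by a function \<open>N\<close>; only the values of \<open>T\<close> and \<open>N\<close> on \<open>S\<close> matter.
\<close>

definition bounded_operator_on ::
    "'v::complex_vector set \<Rightarrow> ('v \<Rightarrow> real) \<Rightarrow> ('v \<Rightarrow> 'v) \<Rightarrow> bool" where
  "bounded_operator_on S N T \<longleftrightarrow>
     (\<forall>x\<in>S. T x \<in> S) \<and>
     (\<forall>x\<in>S. \<forall>y\<in>S. T (x + y) = T x + T y) \<and>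
     (\<forall>c. \<forall>x\<in>S. T (c *\<^sub>C x) = c *\<^sub>C T x) \<and>
     (\<exists>K. \<forall>x\<in>S. N (T x) \<le> K * N x)"

definition delta_hypercyclic_vector_on ::
    "'v::complex_vector set \<Rightarrow> ('v \<Rightarrow> real) \<Rightarrow> real \<Rightarrow> ('v \<Rightarrow> 'v) \<Rightarrow> 'v \<Rightarrow> bool" where
  "delta_hypercyclic_vector_on S N \<delta> T x \<longleftrightarrow>
     x \<in> S \<and> (\<forall>y\<in>S. y \<noteq> 0 \<longrightarrow> (\<exists>n::nat. N ((T ^^ n) x - y) \<le> \<delta> * N y))"

definition delta_hypercyclic_on ::
    "'v::complex_vector set \<Rightarrow> ('v \<Rightarrow> real) \<Rightarrow> real \<Rightarrow> ('v \<Rightarrow> 'v) \<Rightarrow> bool" where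
  "delta_hypercyclic_on S N \<delta> T \<longleftrightarrow> (\<exists>x. delta_hypercyclic_vector_on S N \<delta> T x)"


section \<open>Bases\<close>

definition schauder_basis :: "(nat \<Rightarrow> 'a::complex_normed_vector) \<Rightarrow> bool" where
  "schauder_basis e \<longleftrightarrow> (\<forall>x. \<exists>!a :: nat \<Rightarrow> complex. (\<lambda>n. a n *\<^sub>C e n) sums x)"

definition normalized :: "(nat \<Rightarrow> 'a::complex_normed_vector) \<Rightarrow> bool" where
  "normalized e \<longleftrightarrow> (\<forall>n. norm (e n) = 1)"

definition unconditional_basis :: "real \<Rightarrow> (nat \<Rightarrow> 'a::complex_normed_vector) \<Rightarrow> bool" where
  "unconditional_basis C e \<longleftrightarrow>
     schauder_basis e \<and> C \<ge> 1 \<and>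
     (\<forall>N. \<forall>a b :: nat \<Rightarrow> complex.
        (\<forall>n\<le>N. cmod (b n) \<le> cmod (a n)) \<longrightarrow>
        norm (\<Sum>n\<le>N. b n *\<^sub>C e n) \<le> C * norm (\<Sum>n\<le>N. a n *\<^sub>C e n))"

definition backward_shift_continuous :: "(nat \<Rightarrow> 'a::complex_normed_vector) \<Rightarrow> bool" where
  "backward_shift_continuous f \<longleftrightarrow>
     (\<exists>B. bounded_operator_on UNIV norm B \<and> B (f 0) = 0 \<and> (\<forall>n. B (f (Suc n)) = f n))"


section \<open>Direct sums along a basis\<close>

definition direct_sum ::
    "(nat \<Rightarrow> 'b::complex_banach) \<Rightarrow> (nat \<Rightarrow> 'a::complex_banach) set" where
  "direct_sum f = {x. summable (\<lambda>n. complex_of_real (norm (x n)) *\<^sub>C f n)}"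

definition direct_sum_norm ::
    "(nat \<Rightarrow> 'b::complex_banach) \<Rightarrow> (nat \<Rightarrow> 'a::complex_banach) \<Rightarrow> real" where
  "direct_sum_norm f x = norm (\<Sum>n. complex_of_real (norm (x n)) *\<^sub>C f n)"

end

theory Submission
  imports Defs
begin

text \<open>
  The operator is a backward shift with operator weights. Let \<open>b\<close> be the normalized basis of the
  summand and \<open>M n\<close> bounded invertible operators on the summand with \<open>M 0 = id\<close>; put
  \<open>T x n = Minv n (M (n + 1) (x (n + 1)))\<close>, where \<open>Minv n\<close> inverts \<open>M n\<close>. The products telescope:
  \<open>(T ^^ m) x n = Minv n (M (n + m) (x (n + m)))\<close>. If all \<open>Minv n \<circ> M (n + 1)\<close> have norm at most a
  common constant, then \<open>T\<close> is bounded, because the backward shift of the basis \<open>f\<close> is.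

  The natural numbers are cut into consecutive blocks. In block \<open>k\<close>, \<open>M n\<close> is the operator
  \<open>stretch k t\<close> which fixes the vector \<open>b (k + 1)\<close>, multiplies the kernel of the functional
  \<open>\<phi> k x = coef x (k + 1) - \<rho> k * coef x 0\<close> by \<open>t\<close>, and hence preserves \<open>\<phi> k\<close>. The factor \<open>t\<close> is
  a power of \<open>4\<close> whose exponent is a tent: it climbs from \<open>0\<close> by one at each step up to the middle
  of the block and then goes down to \<open>0\<close> again. Neighbouring powers differ by a factor of at most
  \<open>4\<close>, which gives the common bound.

  The upper threshold. In block \<open>k\<close> huge factors make every vector of the kernel of \<open>\<phi> k\<close>
  reachable from a tiny one. So if \<open>y k\<close> are finitely supported sequences with entries in these
  kernels, and if the blocks grow fast enough, then one single \<open>x\<close> satisfies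
  \<open>(T ^^ N k) x \<approx> y k\<close> for suitable \<open>N k\<close> (lemma \<open>orbit_approximates\<close>). A given \<open>z\<close> need not lie in
  the kernel, but it can be moved there by changing the coordinate \<open>0\<close> of each entry and creating a
  coordinate \<open>k + 1\<close>; the cost of this is controlled by \<open>\<rho> k\<close>.

  The lower threshold. For every \<open>x\<close> and \<open>n\<close> the entry \<open>0\<close> of \<open>(T ^^ n) x\<close> is \<open>M n (x n)\<close>, whose
  value under \<open>\<phi> k\<close> is that of \<open>x n\<close>, and so is bounded independently of \<open>n\<close>. For a large constant
  \<open>c\<close>, an orbit element close to \<open>c *\<^sub>R b 0\<close> (placed at entry \<open>0\<close>) must therefore have an unwanted
  coordinate \<open>k + 1\<close> of about \<open>\<rho> k\<close> times its coordinate \<open>0\<close>.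

  Both costs are the same number if \<open>\<rho> k\<close> is chosen well. In the plane spanned by \<open>b 0\<close> and
  \<open>b (k + 1)\<close>, the smallest error in approximating \<open>b 0\<close> by a multiple of \<open>b 0 + \<rho> k *\<^sub>R b (k + 1)\<close>
  is the distance of a line from the origin. Choosing \<open>\<rho> k\<close> such that this line touches the ball of
  radius \<open>\<epsilon>\<close> makes that error exactly \<open>\<epsilon>\<close> (lemma \<open>tangent_line\<close>), for all \<open>k\<close>, with
  \<open>\<rho> k\<close> bounded. Passing from this plane to the whole direct sum costs nothing, since both bases are
  \<open>1\<close>-unconditional.
\<close>

section \<open>Complex scalar multiplication\<close>

lemma bounded_linear_scaleC_right:
  "bounded_linear (\<lambda>x :: 'a::complex_normed_vector. c *\<^sub>C x)"
proof (rule bounded_linear_intro[where K = "cmod c"])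
  fix r :: real and x :: 'a
  show "c *\<^sub>C (r *\<^sub>R x) = r *\<^sub>R (c *\<^sub>C x)"
    by (simp add: scaleC_of_real[symmetric] scaleC_scaleC mult.commute)
qed (simp_all add: scaleC_add_right norm_scaleC mult.commute)

lemma scaleR_scaleC: "r *\<^sub>R (c *\<^sub>C x) = (of_real r * c) *\<^sub>C (x :: 'a::complex_normed_vector)"
  by (simp add: scaleC_of_real[symmetric] scaleC_scaleC)

lemma scaleC_scaleR: "c *\<^sub>C (r *\<^sub>R x) = (of_real r * c) *\<^sub>C (x :: 'a::complex_normed_vector)"
  by (simp add: scaleC_of_real[symmetric] scaleC_scaleC mult.commute)


section \<open>Coordinates in a normalized unconditional basis\<close>

locale normalized_unconditional_basis =
  fixes b :: "nat \<Rightarrow> 'c::complex_banach"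
  assumes unconditional: "unconditional_basis 1 b"
    and normalized: "normalized b"
begin

lemma norm_basis [simp]: "norm (b n) = 1"
  using normalized by (simp add: normalized_def)

lemma sum_mono_unconditional:
  assumes "finite A" and le: "\<And>n. n \<in> A \<Longrightarrow> cmod (c n) \<le> cmod (a n)"
  shows "norm (\<Sum>n\<in>A. c n *\<^sub>C b n) \<le> norm (\<Sum>n\<in>A. a n *\<^sub>C b n)"
proof -
  obtain N where N: "A \<subseteq> {..N}"
    using finite_nat_iff_bounded_le assms(1) by blast
  have ext: "(\<Sum>n\<in>A. g n *\<^sub>C b n) = (\<Sum>n\<le>N. (if n \<in> A then g n else 0) *\<^sub>C b n)" for g
    by (rule sum.mono_neutral_cong_left) (use N in auto)
  have un: "(\<forall>n\<le>N. cmod (c' n) \<le> cmod (a' n)) \<longrightarrow>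
      norm (\<Sum>n\<le>N. c' n *\<^sub>C b n) \<le> 1 * norm (\<Sum>n\<le>N. a' n *\<^sub>C b n)" for c' a' :: "nat \<Rightarrow> complex"
    using unconditional unfolding unconditional_basis_def by blast
  show ?thesis
    unfolding ext
    using un[of "\<lambda>n. if n \<in> A then c n else 0" "\<lambda>n. if n \<in> A then a n else 0"] le by simp
qed

text \<open>The domination of finite sums, applied to intervals, is a Cauchy criterion.\<close>

lemma summable_dominated:
  assumes a: "summable (\<lambda>n. a n *\<^sub>C b n)" and le: "\<And>n. cmod (c n) \<le> cmod (a n)"
  shows "summable (\<lambda>n. c n *\<^sub>C b n)"
  unfolding summable_Cauchy
proof (intro allI impI)
  fix \<eta> :: real assume "\<eta> > 0"
  then obtain N where N: "\<forall>m\<ge>N. \<forall>n. norm (\<Sum>i\<in>{m..<n}. a i *\<^sub>C b i) < \<eta>"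
    using a unfolding summable_Cauchy by blast
  moreover have "norm (\<Sum>i\<in>{m..<n}. c i *\<^sub>C b i) \<le> norm (\<Sum>i\<in>{m..<n}. a i *\<^sub>C b i)" for m n
    by (rule sum_mono_unconditional) (simp_all add: le)
  ultimately show "\<exists>N. \<forall>m\<ge>N. \<forall>n. norm (\<Sum>i\<in>{m..<n}. c i *\<^sub>C b i) < \<eta>"
    by (blast intro: le_less_trans)
qed

lemma norm_suminf_dominated:
  assumes a: "summable (\<lambda>n. a n *\<^sub>C b n)" and le: "\<And>n. cmod (c n) \<le> cmod (a n)"
  shows "norm (\<Sum>n. c n *\<^sub>C b n) \<le> norm (\<Sum>n. a n *\<^sub>C b n)"
proof (rule LIMSEQ_le)
  show "(\<lambda>N. norm (\<Sum>n<N. c n *\<^sub>C b n)) \<longlonglongrightarrow> norm (\<Sum>n. c n *\<^sub>C b n)"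
    by (intro tendsto_norm summable_LIMSEQ summable_dominated[OF a le])
  show "(\<lambda>N. norm (\<Sum>n<N. a n *\<^sub>C b n)) \<longlonglongrightarrow> norm (\<Sum>n. a n *\<^sub>C b n)"
    by (intro tendsto_norm summable_LIMSEQ a)
  show "\<exists>N. \<forall>n\<ge>N. norm (\<Sum>i<n. c i *\<^sub>C b i) \<le> norm (\<Sum>i<n. a i *\<^sub>C b i)"
    by (intro exI allI impI sum_mono_unconditional) (simp_all add: le)
qed

definition coef :: "'c \<Rightarrow> nat \<Rightarrow> complex" where
  "coef x = (THE a. (\<lambda>n. a n *\<^sub>C b n) sums x)"

lemma ex1_coef: "\<exists>!a. (\<lambda>n. a n *\<^sub>C b n) sums x"
  using unconditional unfolding unconditional_basis_def schauder_basis_def by blast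

lemma coef_sums: "(\<lambda>n. coef x n *\<^sub>C b n) sums x"
  unfolding coef_def by (rule theI'[OF ex1_coef])

lemma coef_unique: "(\<lambda>n. a n *\<^sub>C b n) sums x \<Longrightarrow> coef x = a"
  using ex1_coef coef_sums by blast

lemma coef_scaleC: "coef (c *\<^sub>C x) n = c * coef x n"
proof -
  have "(\<lambda>n. (c * coef x n) *\<^sub>C b n) sums (c *\<^sub>C x)"
    using bounded_linear.sums[OF bounded_linear_scaleC_right coef_sums, of c x]
    by (simp add: scaleC_scaleC)
  from coef_unique[OF this] show ?thesis by simp
qed

lemma coef_scaleR: "coef (r *\<^sub>R x) n = of_real r * coef x n"
  using coef_scaleC[of "of_real r" x n] by (simp add: scaleC_of_real)

lemma coef_add: "coef (x + y) n = coef x n + coef y n"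
proof -
  have "(\<lambda>n. (coef x n + coef y n) *\<^sub>C b n) sums (x + y)"
    using sums_add[OF coef_sums coef_sums, of x y] by (simp add: scaleC_add_left)
  from coef_unique[OF this] show ?thesis by simp
qed

lemma coef_diff: "coef (x - y) n = coef x n - coef y n"
proof -
  have "(\<lambda>n. (coef x n - coef y n) *\<^sub>C b n) sums (x - y)"
    using sums_diff[OF coef_sums coef_sums, of x y] by (simp add: complex_vector.scale_left_diff_distrib)
  from coef_unique[OF this] show ?thesis by simp
qed

lemma coef_basis: "coef (b k) n = (if n = k then 1 else 0)"
proof -
  have "(\<lambda>n. if n = k then b n else 0) sums b k"
    by (rule sums_single)
  then have "(\<lambda>n. (if n = k then 1 else 0) *\<^sub>C b n) sums b k"
    by (rule back_subst[where P = "\<lambda>g. g sums b k"])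
       (auto simp: fun_eq_iff)
  from coef_unique[OF this] show ?thesis by simp
qed

lemmas coef_simps = coef_scaleC coef_scaleR coef_add coef_diff coef_basis

lemma norm_sum_le_of_coef:
  assumes "finite A" and le: "\<And>n. n \<in> A \<Longrightarrow> cmod (c n) \<le> cmod (coef x n)"
  shows "norm (\<Sum>n\<in>A. c n *\<^sub>C b n) \<le> norm x"
proof -
  have "(\<Sum>n. (if n \<in> A then c n else 0) *\<^sub>C b n) = (\<Sum>n\<in>A. (if n \<in> A then c n else 0) *\<^sub>C b n)"
    by (rule suminf_finite) (auto simp: assms(1))
  moreover have "norm (\<Sum>n. (if n \<in> A then c n else 0) *\<^sub>C b n) \<le> norm (\<Sum>n. coef x n *\<^sub>C b n)"
    by (rule norm_suminf_dominated) (use le coef_sums[of x] in \<open>auto simp: sums_iff\<close>)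
  ultimately show ?thesis
    using coef_sums[of x] by (simp add: sums_iff cong: sum.cong)
qed

lemma norm_coef_le: "cmod (coef x n) \<le> norm x"
  using norm_sum_le_of_coef[of "{n}" "coef x" x] by (simp add: norm_scaleC)

lemma coef_tendsto_zero: "(\<lambda>n. cmod (coef x n)) \<longlonglongrightarrow> 0"
proof -
  have "(\<lambda>n. coef x n *\<^sub>C b n) \<longlonglongrightarrow> 0"
    using coef_sums[of x] by (intro summable_LIMSEQ_zero) (simp add: sums_iff)
  then show ?thesis
    using tendsto_norm_zero by (fastforce simp: norm_scaleC)
qed

end

text \<open>A vanishing basis vector would give \<open>0\<close> two different expansions.\<close>

lemma schauder_basis_nonzero:
  assumes "schauder_basis e"
  shows "e n \<noteq> 0"
proof
  assume "e n = 0"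
  then have "(\<lambda>m. (if m = n then 1 else 0) *\<^sub>C e m) = (\<lambda>_. 0)"
    by (auto simp: fun_eq_iff)
  then have one: "(\<lambda>m. (if m = n then 1 else 0) *\<^sub>C e m) sums 0"
    and zero: "(\<lambda>m. 0 *\<^sub>C e m) sums 0"
    by simp_all
  obtain a where unique: "\<And>c. (\<lambda>m. c m *\<^sub>C e m) sums 0 \<Longrightarrow> c = a"
    using spec[OF iffD1[OF schauder_basis_def assms], of 0] by (elim ex1E) (rule that, simp)
  have "(\<lambda>m. if m = n then 1 else 0) = (\<lambda>m. 0 :: complex)"
    using unique[OF one] unique[OF zero] by simp
  from fun_cong[OF this, of n] show False by simp
qed

text \<open>
  Normalizing only rescales the coefficients, and the moduli of two families of coefficients are
  compared index by index, so the unconditionality constant is unchanged.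
\<close>

lemma normalize_unconditional_basis:
  fixes e :: "nat \<Rightarrow> 'a::complex_banach"
  assumes "unconditional_basis C e"
  defines "e' \<equiv> \<lambda>n. (1 / norm (e n)) *\<^sub>R e n"
  shows "unconditional_basis C e'" and "normalized e'"
proof -
  have sb: "schauder_basis e"
    using assms(1) by (simp add: unconditional_basis_def)
  note nz = schauder_basis_nonzero[OF sb]
  show "normalized e'"
    using nz by (simp add: normalized_def e'_def)
  have to_e: "c *\<^sub>C e' n = (c / norm (e n)) *\<^sub>C e n" for c and n
    by (simp add: e'_def scaleC_scaleR divide_simps)
  have to_e': "c *\<^sub>C e n = (c * norm (e n)) *\<^sub>C e' n" for c and n
    using nz[of n] unfolding to_e by simp
  have "schauder_basis e'"
    unfolding schauder_basis_def
  proof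
    fix x
    obtain a where a: "(\<lambda>n. a n *\<^sub>C e n) sums x"
      and unique: "\<And>a'. (\<lambda>n. a' n *\<^sub>C e n) sums x \<Longrightarrow> a' = a"
      using spec[OF iffD1[OF schauder_basis_def sb], of x]
      by (elim ex1E) (rule that, assumption, drule spec, erule mp, assumption)
    show "\<exists>!a. (\<lambda>n. a n *\<^sub>C e' n) sums x"
    proof
      show "(\<lambda>n. (a n * norm (e n)) *\<^sub>C e' n) sums x"
        using a by (simp add: to_e'[symmetric])
      fix a' assume "(\<lambda>n. a' n *\<^sub>C e' n) sums x"
      then have "(\<lambda>n. a' n / norm (e n)) = a"
        by (intro unique) (simp add: to_e)
      then show "a' = (\<lambda>n. a n * norm (e n))"
        using nz by (auto simp: fun_eq_iff field_simps)
    qed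
  qed
  moreover have un: "(\<forall>n\<le>N. cmod (c n) \<le> cmod (a n)) \<longrightarrow>
      norm (\<Sum>n\<le>N. c n *\<^sub>C e n) \<le> C * norm (\<Sum>n\<le>N. a n *\<^sub>C e n)" for N and a c :: "nat \<Rightarrow> complex"
    using assms(1) unfolding unconditional_basis_def by blast
  have "norm (\<Sum>n\<le>N. c n *\<^sub>C e' n) \<le> C * norm (\<Sum>n\<le>N. a n *\<^sub>C e' n)"
    if "\<forall>n\<le>N. cmod (c n) \<le> cmod (a n)" for N and a c :: "nat \<Rightarrow> complex"
  proof -
    have "\<forall>n\<le>N. cmod (c n / norm (e n)) \<le> cmod (a n / norm (e n))"
      using that by (simp add: norm_divide divide_right_mono)
    with un[of N "\<lambda>n. c n / norm (e n)" "\<lambda>n. a n / norm (e n)"] show ?thesis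
      unfolding to_e by blast
  qed
  ultimately show "unconditional_basis C e'"
    using assms(1) by (simp add: unconditional_basis_def)
qed


section \<open>The direct sum as a normed lattice\<close>

context normalized_unconditional_basis
begin

text \<open>
  The sequences in the next lemmas may have entries in different spaces. With a complex-valued \<open>y\<close>
  they compare a vector of the direct sum with a sequence of numbers.
\<close>

lemma direct_sum_mono:
  assumes y: "y \<in> direct_sum b" and le: "\<And>n. norm (x n) \<le> norm (y n)"
  shows "x \<in> direct_sum b" and "direct_sum_norm b x \<le> direct_sum_norm b y"
  using summable_dominated[of "\<lambda>n. of_real (norm (y n))" "\<lambda>n. of_real (norm (x n))"]
    norm_suminf_dominated[of "\<lambda>n. of_real (norm (y n))" "\<lambda>n. of_real (norm (x n))"] assms
  by (simp_all add: direct_sum_def direct_sum_norm_def)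

lemma direct_sum_le_add:
  assumes "u \<in> direct_sum b" "v \<in> direct_sum b"
    and le: "\<And>n. norm (x n) \<le> norm (u n) + norm (v n)"
  shows "x \<in> direct_sum b"
    and "direct_sum_norm b x \<le> direct_sum_norm b u + direct_sum_norm b v"
proof -
  let ?u = "\<lambda>n. complex_of_real (norm (u n)) *\<^sub>C b n"
  let ?v = "\<lambda>n. complex_of_real (norm (v n)) *\<^sub>C b n"
  let ?w = "\<lambda>n. complex_of_real (norm (u n) + norm (v n))"
  have su: "summable ?u" and sv: "summable ?v"
    using assms by (simp_all add: direct_sum_def)
  have split: "?w n *\<^sub>C b n = ?u n + ?v n" for n
    by (simp add: scaleC_add_left)
  have w: "?w \<in> direct_sum b"
    using summable_add[OF su sv] unfolding direct_sum_def
    by (simp add: split flip: of_real_add)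
  have x: "norm (x n) \<le> norm (?w n)" for n
    using le[of n] by (simp flip: of_real_add)
  show "x \<in> direct_sum b" by (rule direct_sum_mono(1)[OF w x])
  have "direct_sum_norm b x \<le> direct_sum_norm b ?w" by (rule direct_sum_mono(2)[OF w x])
  also have "direct_sum_norm b ?w = norm ((\<Sum>n. ?u n) + (\<Sum>n. ?v n))"
    unfolding suminf_add[OF su sv] direct_sum_norm_def by (simp add: split flip: of_real_add)
  also have "\<dots> \<le> direct_sum_norm b u + direct_sum_norm b v"
    unfolding direct_sum_norm_def by (rule norm_triangle_ineq)
  finally show "direct_sum_norm b x \<le> direct_sum_norm b u + direct_sum_norm b v" .
qed

lemma direct_sum_scaled:
  assumes u: "u \<in> direct_sum b" and r: "r \<ge> 0" and le: "\<And>n. norm (x n) \<le> r * norm (u n)"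
  shows "x \<in> direct_sum b" and "direct_sum_norm b x \<le> r * direct_sum_norm b u"
proof -
  let ?u = "\<lambda>n. complex_of_real (norm (u n)) *\<^sub>C b n"
  let ?w = "\<lambda>n. complex_of_real (r * norm (u n))"
  have su: "summable ?u" using u by (simp add: direct_sum_def)
  have split: "?w n *\<^sub>C b n = r *\<^sub>R ?u n" for n
    by (simp add: scaleR_scaleC)
  have nw: "norm (?w n) = r * norm (u n)" for n
    using r by (simp add: norm_mult)
  have w: "?w \<in> direct_sum b"
    unfolding direct_sum_def nw using summable_scaleR_right[OF su, of r]
    by (simp only: mem_Collect_eq nw split)
  have x: "norm (x n) \<le> norm (?w n)" for n
    using le[of n] nw[of n] by linarith
  show "x \<in> direct_sum b" by (rule direct_sum_mono(1)[OF w x])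
  have "direct_sum_norm b x \<le> direct_sum_norm b ?w" by (rule direct_sum_mono(2)[OF w x])
  also have "direct_sum_norm b ?w = norm (r *\<^sub>R (\<Sum>n. ?u n))"
    unfolding direct_sum_norm_def nw suminf_scaleR_right[OF su] by (simp only: split)
  also have "\<dots> = r * direct_sum_norm b u"
    using r by (simp add: direct_sum_norm_def)
  finally show "direct_sum_norm b x \<le> r * direct_sum_norm b u" .
qed

lemma direct_sum_of_summable:
  assumes "summable (\<lambda>n. norm (x n))"
  shows "x \<in> direct_sum b" and "direct_sum_norm b x \<le> (\<Sum>n. norm (x n))"
proof -
  have n: "norm (complex_of_real (norm (x n)) *\<^sub>C b n) = norm (x n)" for n
    by (simp add: norm_scaleC)
  show "x \<in> direct_sum b"
    unfolding direct_sum_def mem_Collect_eq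
    by (rule summable_norm_cancel) (use assms in \<open>simp only: n\<close>)
  show "direct_sum_norm b x \<le> (\<Sum>n. norm (x n))"
    unfolding direct_sum_norm_def
    using summable_norm[of "\<lambda>n. complex_of_real (norm (x n)) *\<^sub>C b n"] assms by (simp add: n)
qed

lemma direct_sum_finite:
  assumes z: "\<And>n. n \<ge> L \<Longrightarrow> x n = 0"
  shows "x \<in> direct_sum b" and "direct_sum_norm b x \<le> (\<Sum>n<L. norm (x n))"
proof -
  have "(\<lambda>n. norm (x n)) sums (\<Sum>n<L. norm (x n))"
    by (rule sums_finite) (use z in \<open>auto simp: not_less\<close>)
  then show "x \<in> direct_sum b" and "direct_sum_norm b x \<le> (\<Sum>n<L. norm (x n))"
    using direct_sum_of_summable[of x] by (auto simp: sums_iff)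
qed

lemma norm_le_direct_sum_norm:
  assumes "x \<in> direct_sum b"
  shows "norm (x n) \<le> direct_sum_norm b x"
proof -
  let ?y = "\<Sum>n. complex_of_real (norm (x n)) *\<^sub>C b n"
  have "coef ?y = (\<lambda>n. complex_of_real (norm (x n)))"
    using assms by (intro coef_unique summable_sums) (simp add: direct_sum_def)
  then show ?thesis
    using norm_coef_le[of ?y n] by (simp add: direct_sum_norm_def)
qed

lemma direct_sum_tail_tendsto_zero:
  assumes "x \<in> direct_sum b"
  shows "(\<lambda>L. direct_sum_norm b (\<lambda>n. if n < L then 0 else x n)) \<longlonglongrightarrow> 0"
proof -
  let ?g = "\<lambda>n. complex_of_real (norm (x n)) *\<^sub>C b n"
  have sg: "summable ?g" using assms by (simp add: direct_sum_def)
  have "direct_sum_norm b (\<lambda>n. if n < L then 0 else x n) = norm (suminf ?g - sum ?g {..<L})" for L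
  proof -
    have "(\<lambda>n. ?g n - (if n \<in> {..<L} then ?g n else 0)) sums (suminf ?g - sum ?g {..<L})"
      by (intro sums_diff summable_sums sg sums_If_finite_set) simp
    moreover have "?g n - (if n \<in> {..<L} then ?g n else 0)
        = complex_of_real (norm (if n < L then 0 else x n)) *\<^sub>C b n" for n
      by simp
    ultimately show ?thesis
      by (simp add: direct_sum_norm_def sums_iff)
  qed
  moreover have "(\<lambda>L. norm (suminf ?g - sum ?g {..<L})) \<longlonglongrightarrow> 0"
    using tendsto_norm[OF tendsto_diff[OF tendsto_const summable_LIMSEQ[OF sg]], of "suminf ?g"]
    by simp
  ultimately show ?thesis by simp
qed

text \<open>
  A bounded operator which shifts the basis vectors shifts the series that defines the norm term by
  term.
\<close>

lemma direct_sum_backward_shift: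
  assumes "backward_shift_continuous b"
  obtains K where "K \<ge> 0"
    and "\<And>x :: nat \<Rightarrow> 'd::complex_banach. x \<in> direct_sum b \<Longrightarrow> (\<lambda>n. x (Suc n)) \<in> direct_sum b"
    and "\<And>x :: nat \<Rightarrow> 'd. x \<in> direct_sum b \<Longrightarrow>
           direct_sum_norm b (\<lambda>n. x (Suc n)) \<le> K * direct_sum_norm b x"
proof -
  obtain B where B: "bounded_operator_on UNIV norm B" and B0: "B (b 0) = 0"
    and BS: "\<And>n. B (b (Suc n)) = b n"
    using assms unfolding backward_shift_continuous_def by blast
  obtain K where K: "\<And>x. norm (B x) \<le> K * norm x"
    using B unfolding bounded_operator_on_def by auto
  have scale: "B (c *\<^sub>C x) = c *\<^sub>C B x" for c x
    using B unfolding bounded_operator_on_def by auto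
  have lin: "bounded_linear B"
  proof (rule bounded_linear_intro[where K = K])
    show "B (r *\<^sub>R x) = r *\<^sub>R B x" for r x
      using scale[of "of_real r" x] by (simp add: scaleC_of_real)
  qed (use B K in \<open>auto simp: bounded_operator_on_def mult.commute\<close>)
  have K0: "K \<ge> 0"
    using order_trans[OF norm_ge_zero K[of "b 0"]] by simp
  have "(\<lambda>n. x (Suc n)) \<in> direct_sum b
      \<and> direct_sum_norm b (\<lambda>n. x (Suc n)) \<le> K * direct_sum_norm b x"
    if "x \<in> direct_sum b" for x :: "nat \<Rightarrow> 'd"
  proof -
    let ?g = "\<lambda>n. complex_of_real (norm (x n)) *\<^sub>C b n"
    have "?g sums suminf ?g" using that by (simp add: direct_sum_def summable_sums)
    then have "(\<lambda>n. B (?g n)) sums B (suminf ?g)" by (rule bounded_linear.sums[OF lin])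
    then have "(\<lambda>n. B (?g (Suc n))) sums B (suminf ?g)"
      unfolding sums_Suc_iff[of "\<lambda>n. B (?g n)"] by (simp add: scale B0)
    then have s: "(\<lambda>n. complex_of_real (norm (x (Suc n))) *\<^sub>C b n) sums B (suminf ?g)"
      by (simp add: scale BS)
    then have "direct_sum_norm b (\<lambda>n. x (Suc n)) = norm (B (suminf ?g))"
      by (simp add: direct_sum_norm_def sums_iff)
    also have "\<dots> \<le> K * direct_sum_norm b x"
      using K[of "suminf ?g"] by (simp add: direct_sum_norm_def)
    finally show ?thesis using s by (auto simp: direct_sum_def sums_iff)
  qed
  with K0 that show thesis by blast
qed

text \<open>
  The finite sequences over a countable dense set of the summand are dense in the direct sum, and
  they are coded by lists of natural numbers. Pairing the code of a list with an arbitrary second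
  number makes each of them occur at infinitely many indices, so that a target can be met again in
  blocks as late as desired.
\<close>

lemma dense_targets:
  assumes sep: "separable_space (euclidean :: 'd::complex_banach topology)"
  obtains zs :: "nat \<Rightarrow> nat \<Rightarrow> 'd::complex_banach" where
    "\<And>y \<eta>. y \<in> direct_sum b \<Longrightarrow> \<eta> > 0 \<Longrightarrow>
       \<exists>z L. (\<forall>i\<ge>L. z i = 0) \<and> direct_sum_norm b (z - y) \<le> \<eta> \<and> infinite {k. zs k = z}"
proof -
  obtain D :: "'d set" where D: "countable D" "closure D = UNIV"
    using sep by (auto simp: separable_space_def euclidean_closure_of)
  have near: "\<exists>n. dist (from_nat_into D n) v < \<eta>" if pos: "\<eta> > 0" for v :: 'd and \<eta>
  proof -
    obtain d where "d \<in> D" "dist d v < \<eta>"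
      using closure_approachable[of v D] D(2) pos by auto
    then show ?thesis using from_nat_into_surj[OF D(1), of d] by auto
  qed
  define zs :: "nat \<Rightarrow> nat \<Rightarrow> 'd" where
    "zs k i = (let l = from_nat (fst (prod_decode k)) in
       if i < length l then from_nat_into D (l ! i) else 0)" for k i
  show thesis
  proof (rule that[of zs])
    fix y :: "nat \<Rightarrow> 'd" and \<eta> :: real assume y: "y \<in> direct_sum b" and \<eta>: "\<eta> > 0"
    let ?tail = "\<lambda>L i. if i < L then 0 else y i"
    have "eventually (\<lambda>L. direct_sum_norm b (?tail L) < \<eta> / 2) sequentially"
      using order_tendstoD(2)[OF direct_sum_tail_tendsto_zero[OF y], of "\<eta> / 2"] \<eta> by simp
    then obtain L where L: "direct_sum_norm b (?tail L) < \<eta> / 2"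
      by (auto simp: eventually_sequentially)
    have "\<forall>i. \<exists>n. dist (from_nat_into D n) (y i) < \<eta> / (2 * (L + 1))"
      using near \<eta> by simp
    then obtain p where p: "\<And>i. dist (from_nat_into D (p i)) (y i) < \<eta> / (2 * (L + 1))"
      by metis
    define z where "z i = (if i < L then from_nat_into D (p i) else 0)" for i
    define u where "u i = (if i < L then z i - y i else 0)" for i
    have "direct_sum_norm b u \<le> (\<Sum>i<L. norm (u i))"
      by (rule direct_sum_finite(2)) (simp add: u_def)
    also have "\<dots> \<le> (\<Sum>i<L. \<eta> / (2 * (L + 1)))"
      using p by (intro sum_mono) (auto simp: u_def z_def dist_norm less_imp_le)
    also have "\<dots> \<le> \<eta> / 2"
      using \<eta> by (simp add: field_simps)
    finally have u: "direct_sum_norm b u \<le> \<eta> / 2" .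
    have "direct_sum_norm b (z - y) \<le> direct_sum_norm b u + direct_sum_norm b (?tail L)"
    proof (rule direct_sum_le_add(2))
      show "u \<in> direct_sum b" by (rule direct_sum_finite(1)[of L]) (simp add: u_def)
      show "?tail L \<in> direct_sum b" by (rule direct_sum_mono(1)[OF y]) simp
    qed (simp add: u_def z_def)
    then have "direct_sum_norm b (z - y) \<le> \<eta>" using u L by simp
    moreover have "infinite {k. zs k = z}"
    proof (rule infinite_super)
      define l where "l = map p [0..<L]"
      show "range (\<lambda>m. prod_encode (to_nat l, m)) \<subseteq> {k. zs k = z}"
        by (auto simp: zs_def z_def l_def fun_eq_iff)
      show "infinite (range (\<lambda>m. prod_encode (to_nat l, m)))"
        by (rule range_inj_infinite) (simp add: inj_def)
    qed
    ultimately show "\<exists>z L. (\<forall>i\<ge>L. z i = 0) \<and> direct_sum_norm b (z - y) \<le> \<eta> \<and> infinite {k. zs k = z}"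
      by (intro exI[of _ z] exI[of _ L]) (simp add: z_def)
  qed
qed

end


section \<open>The tangent line\<close>

context normalized_unconditional_basis
begin

text \<open>
  In the coordinates \<open>(t, q)\<close> of the plane spanned by \<open>b 0\<close> and \<open>b k\<close>, the number \<open>\<rho>\<close> is minus the
  slope of the line \<open>q = \<rho> * (1 - t)\<close> through \<open>(1, 0)\<close> which touches the ball of radius \<open>\<epsilon>\<close> in the
  positive quadrant, and \<open>(\<sigma>, \<rho> * (1 - \<sigma>))\<close> is a point of contact. It is found by maximizing the
  quotient \<open>q / (1 - t)\<close> over the part of the ball in the quadrant: a point of the open ball on or
  beyond the line could be moved upwards within the ball and would have a larger quotient. The bound on
  \<open>\<rho>\<close> is the same for all \<open>k\<close> because both coordinates of a point of the ball are at most \<open>\<epsilon>\<close>.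
\<close>

lemma tangent_line:
  fixes \<epsilon> :: real
  assumes eps: "0 < \<epsilon>" "\<epsilon> < 1" and k: "k \<noteq> 0"
  obtains \<rho> \<sigma> where "0 \<le> \<rho>" "\<rho> \<le> \<epsilon> / (1 - \<epsilon>)"
    and "norm ((\<rho> * (1 - \<sigma>)) *\<^sub>R b k - \<sigma> *\<^sub>R b 0) \<le> \<epsilon>"
    and "\<And>t q. t \<ge> 0 \<Longrightarrow> q \<ge> \<rho> * (1 - t) \<Longrightarrow> q \<ge> 0 \<Longrightarrow> \<epsilon> \<le> norm (t *\<^sub>R b 0 + q *\<^sub>R b k)"
proof -
  let ?n = "\<lambda>t q :: real. norm (t *\<^sub>R b 0 + q *\<^sub>R b k)"
  have coords: "\<bar>t\<bar> \<le> ?n t q" "\<bar>q\<bar> \<le> ?n t q" for t q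
    using norm_coef_le[of "t *\<^sub>R b 0 + q *\<^sub>R b k" 0] norm_coef_le[of "t *\<^sub>R b 0 + q *\<^sub>R b k" k] k
    by (simp_all add: coef_simps)
  define D where "D = {p. 0 \<le> fst p \<and> 0 \<le> snd p \<and> ?n (fst p) (snd p) \<le> \<epsilon>}"
  have "closed D"
    unfolding D_def by (intro closed_Collect_conj closed_Collect_le continuous_intros)
  moreover have "bounded D"
  proof (rule bounded_subset)
    show "bounded ({-\<epsilon>..\<epsilon>} \<times> {-\<epsilon>..\<epsilon>})"
      by (intro bounded_Times bounded_closed_interval)
    show "D \<subseteq> {-\<epsilon>..\<epsilon>} \<times> {-\<epsilon>..\<epsilon>}"
    proof
      fix p assume "p \<in> D"
      then have "\<bar>fst p\<bar> \<le> \<epsilon>" "\<bar>snd p\<bar> \<le> \<epsilon>"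
        using coords[where t = "fst p" and q = "snd p"] unfolding D_def by auto
      then show "p \<in> {-\<epsilon>..\<epsilon>} \<times> {-\<epsilon>..\<epsilon>}"
        by (cases p) auto
    qed
  qed
  ultimately have "compact D" by (simp add: compact_eq_bounded_closed)
  moreover have "(0, 0) \<in> D" using eps by (simp add: D_def)
  moreover have small: "fst p \<le> \<epsilon>" "snd p \<le> \<epsilon>" if "p \<in> D" for p
    using that coords[where t = "fst p" and q = "snd p"] unfolding D_def by auto
  then have "continuous_on D (\<lambda>p. snd p / (1 - fst p))"
    using eps by (intro continuous_intros) fastforce
  ultimately obtain p where p: "p \<in> D" and max: "\<And>p'. p' \<in> D \<Longrightarrow> snd p' / (1 - fst p') \<le> snd p / (1 - fst p)"
    using continuous_attains_sup[of D "\<lambda>p. snd p / (1 - fst p)"] by blast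
  define \<rho> where "\<rho> = snd p / (1 - fst p)"
  have fp: "fst p \<le> \<epsilon>" "0 \<le> snd p" "snd p \<le> \<epsilon>" using small p by (auto simp: D_def)
  show thesis
  proof (rule that[of \<rho> "fst p"])
    show "0 \<le> \<rho>" using fp eps by (simp add: \<rho>_def)
    show "\<rho> \<le> \<epsilon> / (1 - \<epsilon>)" unfolding \<rho>_def by (rule frac_le) (use fp eps in auto)
    have "\<rho> * (1 - fst p) = snd p" using fp eps by (simp add: \<rho>_def)
    \<comment> \<open>The point of contact is reflected at an axis, which changes only the sign of a coefficient.\<close>
    have "norm (snd p *\<^sub>R b k - fst p *\<^sub>R b 0) = norm (\<Sum>n\<in>{0,k}. (if n = 0 then - complex_of_real (fst p) else of_real (snd p)) *\<^sub>C b n)"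
      using k by (simp add: scaleC_of_real)
    also have "\<dots> \<le> norm (\<Sum>n\<in>{0,k}. (if n = 0 then complex_of_real (fst p) else of_real (snd p)) *\<^sub>C b n)"
      by (rule sum_mono_unconditional) auto
    also have "\<dots> = ?n (fst p) (snd p)"
      using k by (simp add: scaleC_of_real)
    also have "\<dots> \<le> \<epsilon>" using p by (simp add: D_def)
    finally show "norm ((\<rho> * (1 - fst p)) *\<^sub>R b k - fst p *\<^sub>R b 0) \<le> \<epsilon>"
      using \<open>\<rho> * (1 - fst p) = snd p\<close> by simp
    fix t q :: real assume t: "t \<ge> 0" and q: "q \<ge> \<rho> * (1 - t)" "q \<ge> 0"
    show "\<epsilon> \<le> ?n t q"
    proof (rule ccontr)
      assume "\<not> \<epsilon> \<le> ?n t q"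
      then obtain \<eta> where \<eta>: "\<eta> > 0" "?n t q + \<eta> \<le> \<epsilon>"
        by (metis add.commute diff_add_cancel diff_gt_0_iff_gt not_le order_refl)
      have "?n t (q + \<eta>) = norm ((t *\<^sub>R b 0 + q *\<^sub>R b k) + \<eta> *\<^sub>R b k)"
        by (simp add: scaleR_add_left add.assoc)
      also have "\<dots> \<le> ?n t q + \<eta>"
        using norm_triangle_ineq[of "t *\<^sub>R b 0 + q *\<^sub>R b k" "\<eta> *\<^sub>R b k"] \<eta> by simp
      finally have "(t, q + \<eta>) \<in> D"
        using t q \<eta> by (simp add: D_def)
      then have "(q + \<eta>) / (1 - t) \<le> \<rho>" and "t \<le> \<epsilon>"
        using max[of "(t, q + \<eta>)"] small(1)[of "(t, q + \<eta>)"] by (simp_all add: \<rho>_def)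
      then have "q + \<eta> \<le> \<rho> * (1 - t)"
        using eps by (simp add: divide_le_eq)
      then show False using q \<eta> by simp
    qed
  qed
qed

text \<open>
  In the block belonging to the line \<open>k\<close> the operator constructed below can only produce vectors
  with \<open>coef x k = \<rho> * coef x 0\<close>. Instead of \<open>z\<close>, the orbit therefore aims at this nearby vector,
  which satisfies that equation. Up to the term \<open>coef z k\<close>, which tends to \<open>0\<close> as \<open>k\<close> grows, the
  displacement is \<open>coef z 0\<close> times the point of contact of the tangent line, so its norm is at most
  \<open>\<epsilon> * norm z\<close>.
\<close>

definition aim :: "real \<Rightarrow> real \<Rightarrow> nat \<Rightarrow> 'c \<Rightarrow> 'c" where
  "aim \<rho> \<sigma> k z = z - coef z k *\<^sub>C b k
     + coef z 0 *\<^sub>C ((\<rho> * (1 - \<sigma>)) *\<^sub>R b k - \<sigma> *\<^sub>R b 0)"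

text \<open>
  If \<open>coef u k\<close> were equal to \<open>\<rho> * coef u 0\<close>, then \<open>t = cmod (coef u 0 - c) / c\<close> and
  \<open>q = cmod (coef u k) / c\<close> would lie beyond the tangent line, because \<open>1 - t \<le> cmod (coef u 0) / c\<close>.
  Unconditionality reduces the norm of \<open>u - c *\<^sub>R b 0\<close> to that of its two coordinates.
\<close>

lemma norm_sub_basis_ge:
  fixes \<rho> c \<epsilon> :: real
  assumes tangent: "\<And>t q. t \<ge> 0 \<Longrightarrow> q \<ge> \<rho> * (1 - t) \<Longrightarrow> q \<ge> 0 \<Longrightarrow> \<epsilon> \<le> norm (t *\<^sub>R b 0 + q *\<^sub>R b k)"
    and \<rho>: "\<rho> \<ge> 0" and c: "c > 0" and k: "k \<noteq> 0"
  shows "\<epsilon> * c - cmod (coef u k - \<rho> * coef u 0) \<le> norm (u - c *\<^sub>R b 0)"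
proof -
  let ?\<phi> = "cmod (coef u k - \<rho> * coef u 0)"
  define a where "a = cmod (coef u 0)"
  define t where "t = cmod (coef u 0 - c)"
  have ac: "c \<le> a + t"
    unfolding a_def t_def
    using norm_triangle_ineq4[of "coef u 0" "coef u 0 - c"] c by simp
  have "\<epsilon> \<le> norm ((t / c) *\<^sub>R b 0 + (\<rho> * a / c) *\<^sub>R b k)"
  proof (rule tangent)
    have "1 - t / c \<le> a / c"
      using divide_right_mono[of "c - t" a c] ac c by (simp add: diff_divide_distrib)
    from mult_left_mono[OF this \<rho>] show "\<rho> * a / c \<ge> \<rho> * (1 - t / c)" by simp
  qed (use \<rho> c in \<open>auto simp: a_def t_def\<close>)
  also have "\<dots> = norm ((1 / c) *\<^sub>R (t *\<^sub>R b 0 + (\<rho> * a) *\<^sub>R b k))"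
    by (simp add: scaleR_add_right)
  also have "\<dots> = norm (t *\<^sub>R b 0 + (\<rho> * a) *\<^sub>R b k) / c"
    using c by simp
  finally have "\<epsilon> * c \<le> norm (t *\<^sub>R b 0 + (\<rho> * a) *\<^sub>R b k)"
    using c by (simp add: pos_le_divide_eq)
  also have "\<dots> \<le> norm (t *\<^sub>R b 0 + cmod (coef u k) *\<^sub>R b k) + norm ((\<rho> * a - cmod (coef u k)) *\<^sub>R b k)"
    by (rule order_trans[OF _ norm_triangle_ineq]) (simp add: algebra_simps)
  also have "norm ((\<rho> * a - cmod (coef u k)) *\<^sub>R b k) \<le> ?\<phi>"
    using norm_triangle_ineq3[of "coef u k" "\<rho> * coef u 0"] \<rho> by (simp add: a_def norm_mult)
  also have "norm (t *\<^sub>R b 0 + cmod (coef u k) *\<^sub>R b k)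
      = norm (\<Sum>n\<in>{0,k}. complex_of_real (if n = 0 then t else cmod (coef u k)) *\<^sub>C b n)"
    using k by (simp add: scaleC_of_real)
  also have "\<dots> \<le> norm (u - c *\<^sub>R b 0)"
    by (rule norm_sum_le_of_coef) (use k in \<open>auto simp: coef_simps t_def\<close>)
  finally show ?thesis by simp
qed

end


section \<open>Backward shifts with tent-shaped weights\<close>

text \<open>
  Block \<open>k\<close> is the interval from \<open>s k\<close> to \<open>s (Suc k)\<close>. It belongs to the basis vector
  \<open>b (Suc k)\<close>, because \<open>b 0\<close> plays a separate role in all blocks.
\<close>

locale tent_weighted_shift = normalized_unconditional_basis b
  for b :: "nat \<Rightarrow> 'c::complex_banach" +
  fixes \<rho> :: "nat \<Rightarrow> real" and R :: real and s :: "nat \<Rightarrow> nat"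
  assumes \<rho>_nonneg: "0 \<le> \<rho> k" and \<rho>_le: "1 + \<rho> k \<le> R"
    and strict_mono_s: "strict_mono s" and s_0: "s 0 = 0"
begin

definition \<phi> :: "nat \<Rightarrow> 'c \<Rightarrow> complex" where
  "\<phi> k x = coef x (Suc k) - \<rho> k * coef x 0"

text \<open>
  Writing \<open>P x = \<phi> k x *\<^sub>C b (Suc k)\<close>, which is a projection because \<open>\<phi> k (b (Suc k)) = 1\<close>, this is
  \<open>t (I - P) + P\<close>, a multiplicative one-parameter group in \<open>t\<close>.
\<close>

definition stretch :: "nat \<Rightarrow> real \<Rightarrow> 'c \<Rightarrow> 'c" where
  "stretch k t x = t *\<^sub>R x - ((t - 1) * \<phi> k x) *\<^sub>C b (Suc k)"

lemma R_ge_1: "1 \<le> R"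
  using \<rho>_nonneg[of 0] \<rho>_le[of 0] by simp

lemma \<phi>_linear:
  "\<phi> k (x + y) = \<phi> k x + \<phi> k y" "\<phi> k (c *\<^sub>C x) = c * \<phi> k x"
  by (simp_all add: \<phi>_def coef_simps algebra_simps)

lemma norm_\<phi>_le: "cmod (\<phi> k x) \<le> R * norm x"
proof -
  have "cmod (\<phi> k x) \<le> cmod (coef x (Suc k)) + \<rho> k * cmod (coef x 0)"
    unfolding \<phi>_def using norm_triangle_ineq4[of "coef x (Suc k)" "\<rho> k * coef x 0"] \<rho>_nonneg[of k]
    by (simp add: norm_mult)
  also have "\<dots> \<le> norm x + \<rho> k * norm x"
    by (intro add_mono mult_left_mono norm_coef_le \<rho>_nonneg)
  also have "\<dots> \<le> R * norm x"
    using mult_right_mono[OF \<rho>_le[of k] norm_ge_zero[of x]] by (simp add: algebra_simps)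
  finally show ?thesis .
qed

lemma \<phi>_stretch: "\<phi> j (stretch k t x) = (if j = k then \<phi> k x else t * \<phi> j x)"
  by (simp add: stretch_def \<phi>_def coef_simps algebra_simps)

lemma stretch_stretch: "stretch k t (stretch k u x) = stretch k (t * u) x"
proof -
  have "stretch k t (stretch k u x)
      = (t * u) *\<^sub>R x - (t * ((u - 1) * \<phi> k x) + (t - 1) * \<phi> k x) *\<^sub>C b (Suc k)"
    unfolding stretch_def[of k t "stretch k u x"] \<phi>_stretch
    by (simp add: stretch_def scaleR_diff_right scaleR_scaleC scaleC_add_left)
  also have "t * ((u - 1) * \<phi> k x) + (t - 1) * \<phi> k x = ((t * u) - 1) * \<phi> k x"
    by (simp add: algebra_simps)
  finally show ?thesis by (simp add: stretch_def)
qed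

lemma stretch_1: "stretch k 1 x = x"
  by (simp add: stretch_def)

lemma stretch_kernel: "\<phi> k x = 0 \<Longrightarrow> stretch k t x = t *\<^sub>R x"
  by (simp add: stretch_def)

lemma stretch_add: "stretch k t (x + y) = stretch k t x + stretch k t y"
  by (simp add: stretch_def \<phi>_linear algebra_simps scaleC_add_left scaleR_add_right)

lemma stretch_scaleC: "stretch k t (c *\<^sub>C x) = c *\<^sub>C stretch k t x"
  by (simp add: stretch_def \<phi>_linear complex_vector.scale_right_diff_distrib scaleR_scaleC
      scaleC_scaleR scaleC_scaleC mult_ac)

lemma norm_stretch_le:
  assumes "0 \<le> t" "t \<le> 4"
  shows "norm (stretch k t x) \<le> (4 + 3 * R) * norm x"
proof -
  have "cmod (complex_of_real t - 1) = \<bar>t - 1\<bar>"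
    by (metis norm_of_real of_real_1 of_real_diff)
  then have "norm (stretch k t x) \<le> t * norm x + \<bar>t - 1\<bar> * cmod (\<phi> k x)"
    unfolding stretch_def
    using norm_triangle_ineq4[of "t *\<^sub>R x" "((t - 1) * \<phi> k x) *\<^sub>C b (Suc k)"] assms
    by (simp add: norm_scaleC norm_mult)
  also have "\<dots> \<le> 4 * norm x + 3 * (R * norm x)"
    using assms by (intro add_mono mult_mono norm_\<phi>_le) auto
  finally show ?thesis by (simp add: algebra_simps)
qed

definition block :: "nat \<Rightarrow> nat" where
  "block n = (LEAST k. n < s (Suc k))"

definition height :: "nat \<Rightarrow> nat" where
  "height n = min (n - s (block n)) (s (Suc (block n)) - n)"

lemma block_eq:
  assumes "s k \<le> n" "n < s (Suc k)"
  shows "block n = k"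
  unfolding block_def
proof (rule Least_equality)
  fix j assume "n < s (Suc j)"
  with assms(1) have "s k < s (Suc j)" by simp
  then show "k \<le> j" using strict_mono_s by (simp add: strict_mono_less)
qed (rule assms(2))

lemma less_s_Suc_block: "n < s (Suc (block n))"
  unfolding block_def
proof (rule LeastI)
  show "n < s (Suc n)"
    using strict_mono_imp_increasing[OF strict_mono_s, of "Suc n"] by simp
qed

lemma s_block_le: "s (block n) \<le> n"
proof (cases "block n")
  case (Suc j)
  then show ?thesis
    using not_less_Least[of j "\<lambda>k. n < s (Suc k)"] by (simp add: block_def)
qed (simp add: s_0)

lemma le_block: "s k \<le> n \<Longrightarrow> k \<le> block n"
  using less_s_Suc_block[of n] strict_mono_s
  by (metis le_less_trans less_Suc_eq_le strict_mono_less)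

definition M :: "nat \<Rightarrow> 'c \<Rightarrow> 'c" where
  "M n = stretch (block n) (4 ^ height n)"

definition Minv :: "nat \<Rightarrow> 'c \<Rightarrow> 'c" where
  "Minv n = stretch (block n) (1 / 4 ^ height n)"

lemma M_Minv: "M n (Minv n x) = x" and Minv_M: "Minv n (M n x) = x"
  by (simp_all add: M_def Minv_def stretch_stretch stretch_1)

lemma Minv_0: "Minv 0 x = x"
  by (simp add: Minv_def height_def stretch_1)

text \<open>
  Within a block the exponent changes by at most one. At a border both neighbouring blocks have
  exponent \<open>0\<close>, where the operators are the identity, so that the change from one functional to the
  next is not noticed.
\<close>

lemma transition:
  obtains t where "0 \<le> t" "t \<le> 4" "\<And>x. Minv n (M (Suc n) x) = stretch (block n) t x"
proof (cases "Suc n < s (Suc (block n))")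
  case True
  have b: "block (Suc n) = block n"
    by (rule block_eq) (use s_block_le[of n] True in auto)
  then have h: "height (Suc n) \<le> Suc (height n)"
    by (simp add: height_def)
  show ?thesis
  proof (rule that[of "1 / 4 ^ height n * 4 ^ height (Suc n)"])
    have "(4 :: real) ^ height (Suc n) \<le> 4 ^ Suc (height n)"
      using h by (intro power_increasing) auto
    then show "1 / 4 ^ height n * 4 ^ height (Suc n) \<le> (4 :: real)"
      by (simp add: divide_le_eq)
  qed (simp_all add: M_def Minv_def b stretch_stretch)
next
  case False
  then have n: "Suc n = s (Suc (block n))" using less_s_Suc_block[of n] by simp
  have "block (Suc n) = Suc (block n)"
    by (rule block_eq) (use n strict_mono_s in \<open>auto simp: strict_mono_less\<close>)
  then have "M (Suc n) x = x" for x
    using n by (simp add: M_def height_def stretch_1)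
  moreover have "1 / 4 ^ height n \<le> (4 :: real)"
    by (rule order_trans[of _ 1]) simp_all
  ultimately show ?thesis
    by (intro that[of "1 / 4 ^ height n"]) (simp_all add: Minv_def)
qed

definition T :: "(nat \<Rightarrow> 'c) \<Rightarrow> nat \<Rightarrow> 'c" where
  "T x = (\<lambda>n. Minv n (M (Suc n) (x (Suc n))))"

lemma T_power: "(T ^^ m) x n = Minv n (M (n + m) (x (n + m)))"
  by (induction m arbitrary: n) (simp_all add: T_def Minv_M M_Minv)

lemma norm_Minv_M_le: "norm (Minv n (M (Suc n) x)) \<le> (4 + 3 * R) * norm x"
  by (rule transition[of n]) (simp add: norm_stretch_le)

lemma norm_T_power_le: "norm ((T ^^ m) x n) \<le> (4 + 3 * R) ^ m * norm (x (n + m))"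
proof (induction m arbitrary: n)
  case (Suc m)
  have "norm ((T ^^ Suc m) x n) \<le> (4 + 3 * R) * norm ((T ^^ m) x (Suc n))"
    using norm_Minv_M_le[of n "(T ^^ m) x (Suc n)"] by (simp add: T_def)
  also have "\<dots> \<le> (4 + 3 * R) * ((4 + 3 * R) ^ m * norm (x (Suc n + m)))"
    using Suc[of "Suc n"] R_ge_1 by (intro mult_left_mono) auto
  finally show ?case by (simp add: mult.assoc)
qed simp

lemma norm_M_le: "norm (M n v) \<le> (4 + 3 * R) ^ n * norm v"
  using norm_T_power_le[of n "\<lambda>_. v" 0] by (simp add: T_power Minv_0)

lemma bounded_operator_T:
  assumes f: "normalized_unconditional_basis f" and shift: "backward_shift_continuous f"
  shows "bounded_operator_on (direct_sum f) (direct_sum_norm f) T"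
proof -
  interpret Y: normalized_unconditional_basis f by (rule f)
  obtain K where K: "K \<ge> 0"
    and in_sum: "\<And>x :: nat \<Rightarrow> 'c. x \<in> direct_sum f \<Longrightarrow> (\<lambda>n. x (Suc n)) \<in> direct_sum f"
    and le: "\<And>x :: nat \<Rightarrow> 'c. x \<in> direct_sum f \<Longrightarrow>
               direct_sum_norm f (\<lambda>n. x (Suc n)) \<le> K * direct_sum_norm f x"
    using Y.direct_sum_backward_shift[OF shift, where 'd = 'c] by blast
  define C where "C = 4 + 3 * R"
  have C: "C \<ge> 0" using R_ge_1 by (simp add: C_def)
  have T: "norm (T x n) \<le> C * norm (x (Suc n))" for x n
    using norm_Minv_M_le by (simp add: T_def C_def)
  have "T x \<in> direct_sum f" if "x \<in> direct_sum f" for x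
    by (rule Y.direct_sum_scaled(1)[where u = "\<lambda>n. x (Suc n)", OF in_sum[OF that] C T[of x]])
  moreover have "direct_sum_norm f (T x) \<le> (C * K) * direct_sum_norm f x" if "x \<in> direct_sum f" for x
    using Y.direct_sum_scaled(2)[where u = "\<lambda>n. x (Suc n)", OF in_sum[OF that] C T[of x]]
      mult_left_mono[OF le[OF that] C]
    by (simp add: mult.assoc)
  moreover have "T (x + y) = T x + T y" "T (c *\<^sub>C x) = c *\<^sub>C T x" for x y c
    by (simp_all add: T_def fun_eq_iff M_def Minv_def stretch_add stretch_scaleC scaleC_fun_def)
  ultimately show ?thesis
    unfolding bounded_operator_on_def by blast
qed

text \<open>
  The target is \<open>c *\<^sub>R b 0\<close> at entry \<open>0\<close>. At this entry the orbit of \<open>x\<close> has bounded values under the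
  functionals \<open>\<phi> k\<close>, so it stays at distance \<open>\<epsilon> * c\<close> from the target up to a constant, and the
  constant becomes negligible as \<open>c\<close> grows.
\<close>

lemma not_delta_hypercyclic:
  fixes \<epsilon> \<delta> :: real
  assumes f: "normalized_unconditional_basis f" and shift: "backward_shift_continuous f"
    and tangent: "\<And>k t q. t \<ge> 0 \<Longrightarrow> q \<ge> \<rho> k * (1 - t) \<Longrightarrow> q \<ge> 0 \<Longrightarrow>
                    \<epsilon> \<le> norm (t *\<^sub>R b 0 + q *\<^sub>R b (Suc k))"
    and \<delta>: "\<delta> < \<epsilon>"
  shows "\<not> delta_hypercyclic_on (direct_sum f) (direct_sum_norm f) \<delta> T"
proof
  interpret Y: normalized_unconditional_basis f by (rule f)
  let ?N = "direct_sum_norm f :: (nat \<Rightarrow> 'c) \<Rightarrow> real"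
  assume "delta_hypercyclic_on (direct_sum f) ?N \<delta> T"
  then obtain x where x: "x \<in> direct_sum f"
    and hyp: "\<And>y. y \<in> direct_sum f \<Longrightarrow> y \<noteq> 0 \<Longrightarrow> \<exists>n. ?N ((T ^^ n) x - y) \<le> \<delta> * ?N y"
    unfolding delta_hypercyclic_on_def delta_hypercyclic_vector_on_def by blast
  \<comment> \<open>Any \<open>c\<close> with \<open>(\<epsilon> - \<delta>) * c > R * ?N x\<close> would do.\<close>
  define c where "c = R * ?N x / (\<epsilon> - \<delta>) + 1"
  have Nx: "?N x \<ge> 0" by (simp add: direct_sum_norm_def)
  then have c: "c > 0" using \<delta> R_ge_1 by (auto simp: c_def intro!: add_nonneg_pos divide_nonneg_pos mult_nonneg_nonneg)
  define y where "y = (\<lambda>n :: nat. if n = 0 then c *\<^sub>R b 0 else 0)"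
  have y: "y \<in> direct_sum f" by (rule Y.direct_sum_finite(1)[of 1]) (simp add: y_def)
  have "?N y \<le> c" using Y.direct_sum_finite(2)[of 1 y] c by (simp add: y_def)
  moreover have "?N y \<ge> c" using Y.norm_le_direct_sum_norm[OF y, of 0] c by (simp add: y_def)
  ultimately have Ny: "?N y = c" by simp
  have "y 0 \<noteq> 0" using c norm_basis[of 0] by (auto simp: y_def simp del: norm_basis)
  then have "y \<noteq> 0" by auto
  then obtain n where n: "?N ((T ^^ n) x - y) \<le> \<delta> * c" using hyp[OF y] Ny by auto
  let ?k = "block n" and ?u = "M n (x n)"
  have "(T ^^ n) x \<in> direct_sum f"
    by (induction n)
       (use x bounded_operator_T[OF f shift] in \<open>simp_all add: bounded_operator_on_def\<close>)
  then have "(T ^^ n) x - y \<in> direct_sum f"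
    by (rule Y.direct_sum_le_add(1)[OF _ y]) (simp add: norm_triangle_ineq4)
  from Y.norm_le_direct_sum_norm[OF this, of 0] n
  have "norm (?u - c *\<^sub>R b 0) \<le> \<delta> * c"
    by (simp add: T_power Minv_0 y_def)
  moreover have "\<epsilon> * c - cmod (\<phi> ?k ?u) \<le> norm (?u - c *\<^sub>R b 0)"
    unfolding \<phi>_def by (rule norm_sub_basis_ge[OF tangent \<rho>_nonneg c]) auto
  moreover have "cmod (\<phi> ?k ?u) \<le> R * ?N x"
  proof -
    have "cmod (\<phi> ?k ?u) \<le> R * norm (x n)"
      using norm_\<phi>_le[of ?k "x n"] by (simp add: M_def \<phi>_stretch)
    also have "\<dots> \<le> R * ?N x"
      using Y.norm_le_direct_sum_norm[OF x] R_ge_1 by (intro mult_left_mono) auto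
    finally show ?thesis .
  qed
  ultimately have "(\<epsilon> - \<delta>) * c \<le> R * ?N x"
    by (simp add: algebra_simps)
  moreover have "(\<epsilon> - \<delta>) * c = R * ?N x + (\<epsilon> - \<delta>)"
    using \<delta> by (simp add: c_def distrib_left)
  ultimately show False using \<delta> by simp
qed

text \<open>
  The vector \<open>x\<close> carries a copy of \<open>y k\<close>, shrunk by powers of \<open>4\<close>, at the entries from
  \<open>N k = s k + g k\<close> onwards, close to the top of the tent. Shifting by \<open>N k\<close> undoes the shrinking. The copies in
  earlier blocks have then been shifted out; those in later blocks are so small that even the norm of
  \<open>T ^^ N k\<close> does not make them visible. Two features of the block lengths matter: after \<open>N k\<close> the
  exponent stays at least \<open>g k\<close> for \<open>k\<close> further entries, and \<open>g k\<close> is large in comparison with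
  \<open>s k\<close>, hence with all \<open>N j\<close> for \<open>j < k\<close>. As the exponent of \<open>4\<close> is about the distance to the
  beginning of the block, the powers of \<open>4\<close> leave room for the summable factor \<open>(1 / 2) ^ n\<close>.
\<close>

lemma orbit_approximates:
  fixes y :: "nat \<Rightarrow> nat \<Rightarrow> 'c" and g :: "nat \<Rightarrow> nat"
  assumes f: "normalized_unconditional_basis f"
    and y: "\<And>k i. \<phi> k (y k i) = 0"
    and s: "\<And>k. s (Suc k) = s k + 2 * g k + k + 1"
    and g: "\<And>k i. i < k \<Longrightarrow> (4 + 3 * R) ^ (s k + i) * 2 ^ (s k + i) * norm (y k i) \<le> 2 ^ g k"
  obtains x where "x \<in> direct_sum f"
    and "\<And>k i. norm ((T ^^ (s k + g k)) x i - (if i < k then y k i else 0)) \<le> (1 / 2) ^ (k + i)"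
proof -
  interpret Y: normalized_unconditional_basis f by (rule f)
  define C where "C = 4 + 3 * R"
  have C: "C \<ge> 1" using R_ge_1 by (simp add: C_def)
  define N where "N k = s k + g k" for k
  define x where "x n = (let k = block n in
      if N k \<le> n \<and> n < N k + k then Minv n (M (n - N k) (y k (n - N k))) else 0)" for n
  have k_le_s: "k \<le> s k" for k by (rule strict_mono_imp_increasing[OF strict_mono_s])
  have block_N: "block (N k + i) = k" if "i \<le> k" for k i
    by (rule block_eq) (use that in \<open>simp_all add: N_def s\<close>)
  have x_N: "x (N k + i) = Minv (N k + i) (M i (y k i))" if "i < k" for k i
    using that block_N[of i k] by (simp add: x_def)
  have small: "norm (x n) \<le> (1 / 2) ^ n / C ^ s (block n)" for n
  proof (cases "N (block n) \<le> n \<and> n < N (block n) + block n")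
    case False
    then show ?thesis using C by (auto simp: x_def Let_def)
  next
    case True
    define k i where "k = block n" and "i = n - N k"
    have n: "n = N k + i" and i: "i < k" using True by (auto simp: k_def i_def)
    have "block i < k"
      using s_block_le[of i] i k_le_s[of k] strict_mono_s
      by (metis (no_types, lifting) le_less_trans less_le_trans strict_mono_less)
    \<comment> \<open>\<open>M i\<close> belongs to an earlier block, so it respects the kernel of \<open>\<phi> k\<close>.\<close>
    then have "\<phi> k (M i (y k i)) = 0"
      by (simp add: M_def \<phi>_stretch y)
    then have "norm (x n) = norm (M i (y k i)) / 4 ^ height n"
      using x_N[OF i] by (simp add: n Minv_def block_N i less_imp_le stretch_kernel)
    also have "\<dots> \<le> C ^ i * norm (y k i) / 4 ^ g k"
    proof (rule frac_le)
      have "g k \<le> height n"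
        using i by (simp add: height_def n block_N less_imp_le s) (simp add: N_def)
      then show "(4 :: real) ^ g k \<le> 4 ^ height n" by (intro power_increasing) auto
    qed (use norm_M_le[of i "y k i"] C in \<open>auto simp: C_def\<close>)
    also have "\<dots> \<le> (1 / 2) ^ n / C ^ s k"
    proof -
      have "C ^ (s k + i) * 2 ^ (s k + i) * norm (y k i) * 2 ^ g k \<le> 2 ^ g k * 2 ^ g k"
        using g[OF i] by (intro mult_right_mono) (auto simp: C_def)
      also have "(2 :: real) ^ g k * 2 ^ g k = 4 ^ g k"
        by (simp flip: power_mult_distrib)
      finally have "C ^ i * norm (y k i) * (2 ^ n * C ^ s k) \<le> 4 ^ g k"
        by (simp add: n N_def power_add mult_ac)
      then show ?thesis
        using C by (simp add: divide_simps power_one_over mult_ac)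
    qed
    finally show ?thesis by (simp add: k_def)
  qed
  have "norm (norm (x n)) \<le> (1 / 2) ^ n" for n
  proof -
    have "(1 / 2 :: real) ^ n / C ^ s (block n) \<le> (1 / 2) ^ n"
      using C by (simp add: divide_le_eq mult_le_cancel_left1)
    with small[of n] show ?thesis by simp
  qed
  then have "summable (\<lambda>n. norm (x n))"
    by (rule summable_comparison_test'[where N = 0, OF summable_geometric, rotated]) simp
  then have "x \<in> direct_sum f"
    by (rule Y.direct_sum_of_summable(1))
  moreover have "norm ((T ^^ N k) x i - (if i < k then y k i else 0)) \<le> (1 / 2) ^ (k + i)" for k i
  proof (cases "i < k")
    case True
    then have "(T ^^ N k) x i = y k i"
      using x_N[OF True] by (simp add: T_power add.commute[of i] M_Minv Minv_M)
    then show ?thesis using True by simp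
  next
    case False
    define n where "n = N k + i"
    have "norm ((T ^^ N k) x i) \<le> C ^ N k * norm (x n)"
      using norm_T_power_le[of "N k" x i] by (simp add: C_def n_def add.commute)
    also have "\<dots> \<le> (1 / 2) ^ n"
    proof (cases "x n = 0")
      case nz: False
      then have window: "n < N (block n) + block n" by (auto simp: x_def Let_def split: if_splits)
      have "k \<le> block n" by (rule le_block) (simp add: n_def N_def)
      moreover have "block n \<noteq> k" using window False by (auto simp: n_def)
      ultimately have "s (Suc k) \<le> s (block n)"
        using strict_mono_s by (simp add: strict_mono_less_eq)
      then have "C ^ N k \<le> C ^ s (block n)"
        using C by (intro power_increasing) (auto simp: s N_def)
      then have "C ^ N k * norm (x n) \<le> C ^ s (block n) * ((1 / 2) ^ n / C ^ s (block n))"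
        using small[of n] C by (intro mult_mono) auto
      then show ?thesis using C by simp
    qed simp
    also have "\<dots> \<le> (1 / 2) ^ (k + i)"
      using k_le_s[of k] by (intro power_decreasing) (auto simp: n_def N_def)
    finally show ?thesis using False by simp
  qed
  ultimately show thesis using that by (simp add: N_def)
qed

text \<open>
  Let \<open>z\<close> be a finitely supported sequence near \<open>w\<close> and \<open>k\<close> a large index with \<open>zs k = z\<close>. The orbit
  comes close to the sequence of the vectors \<open>aim\<close> for the entries of \<open>z\<close>, and each of these differs
  from the entry by at most \<open>\<epsilon>\<close> times the norm of the entry, plus a vanishing coordinate. By
  monotonicity of the norm of the direct sum, the distance from the orbit to \<open>z\<close> is at most \<open>\<epsilon>\<close>
  times the norm of \<open>z\<close>, up to small terms. These fit into the gap between \<open>\<epsilon>\<close> and \<open>\<delta>\<close>.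
\<close>

lemma delta_hypercyclic:
  fixes \<epsilon> \<delta> :: real and zs :: "nat \<Rightarrow> nat \<Rightarrow> 'c" and \<sigma> :: "nat \<Rightarrow> real" and g :: "nat \<Rightarrow> nat"
  assumes f: "normalized_unconditional_basis f"
    and contact: "\<And>k. norm ((\<rho> k * (1 - \<sigma> k)) *\<^sub>R b (Suc k) - \<sigma> k *\<^sub>R b 0) \<le> \<epsilon>"
    and dense: "\<And>w \<eta>. w \<in> direct_sum f \<Longrightarrow> \<eta> > 0 \<Longrightarrow>
       \<exists>z L. (\<forall>i\<ge>L. z i = 0) \<and> direct_sum_norm f (z - w) \<le> \<eta> \<and> infinite {k. zs k = z}"
    and s: "\<And>k. s (Suc k) = s k + 2 * g k + k + 1"
    and g: "\<And>k i. i < k \<Longrightarrow>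
       (4 + 3 * R) ^ (s k + i) * 2 ^ (s k + i) * norm (aim (\<rho> k) (\<sigma> k) (Suc k) (zs k i)) \<le> 2 ^ g k"
    and \<epsilon>: "0 \<le> \<epsilon>" and \<delta>: "\<epsilon> < \<delta>" "\<delta> \<le> 1"
  shows "delta_hypercyclic_on (direct_sum f) (direct_sum_norm f) \<delta> T"
proof -
  interpret Y: normalized_unconditional_basis f by (rule f)
  let ?N = "direct_sum_norm f :: (nat \<Rightarrow> 'c) \<Rightarrow> real"
  define y where "y k i = aim (\<rho> k) (\<sigma> k) (Suc k) (zs k i)" for k i
  have "\<phi> k (y k i) = 0" for k i
    by (simp add: \<phi>_def y_def aim_def coef_simps algebra_simps)
  from orbit_approximates[OF f this s g[folded y_def]] obtain x where x: "x \<in> direct_sum f"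
    and orbit: "\<And>k i. norm ((T ^^ (s k + g k)) x i - (if i < k then y k i else 0)) \<le> (1 / 2) ^ (k + i)"
    by blast
  have "\<exists>n. ?N ((T ^^ n) x - w) \<le> \<delta> * ?N w" if w: "w \<in> direct_sum f" and nz: "w \<noteq> 0" for w
  proof -
    obtain j where "w j \<noteq> 0" using nz by (auto simp: fun_eq_iff)
    then have Nw: "?N w > 0"
      using less_le_trans[OF _ Y.norm_le_direct_sum_norm[OF w, of j], of 0] by simp
    \<comment> \<open>Four errors of size \<open>\<eta>\<close> add up below: two from replacing \<open>w\<close> by \<open>z\<close>, one from the
      coordinates \<open>coef (z i) (Suc k)\<close>, and one from the orbit.\<close>
    define \<eta> where "\<eta> = (\<delta> - \<epsilon>) * ?N w / 4"
    have \<eta>: "\<eta> > 0" using \<delta> Nw by (simp add: \<eta>_def)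
    obtain z L where z0: "\<And>i. i \<ge> L \<Longrightarrow> z i = 0" and zw: "?N (z - w) \<le> \<eta>"
      and inf: "infinite {k. zs k = z}"
      using dense[OF w \<eta>] by blast
    have "(\<lambda>k. \<Sum>i<L. cmod (coef (z i) (Suc k))) \<longlonglongrightarrow> (\<Sum>i<L. 0)"
      by (intro tendsto_sum filterlim_compose[OF coef_tendsto_zero filterlim_Suc])
    then have "\<forall>\<^sub>F k in sequentially. (\<Sum>i<L. cmod (coef (z i) (Suc k))) < \<eta>"
      using \<eta> by (intro order_tendstoD) auto
    moreover have "(\<lambda>k. 2 * (1 / 2 :: real) ^ k) \<longlonglongrightarrow> 2 * 0"
      by (intro tendsto_intros) simp
    then have "\<forall>\<^sub>F k in sequentially. 2 * (1 / 2) ^ k < \<eta>"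
      using \<eta> by (intro order_tendstoD) auto
    moreover have "\<forall>\<^sub>F k in sequentially. L \<le> k" by (rule eventually_ge_at_top)
    ultimately have "\<forall>\<^sub>F k in sequentially. (\<Sum>i<L. cmod (coef (z i) (Suc k))) < \<eta>
        \<and> 2 * (1 / 2) ^ k < \<eta> \<and> L \<le> k"
      by eventually_elim simp
    then obtain k0 where k0: "\<And>k. k \<ge> k0 \<Longrightarrow> (\<Sum>i<L. cmod (coef (z i) (Suc k))) < \<eta>
        \<and> 2 * (1 / 2) ^ k < \<eta> \<and> L \<le> k"
      unfolding eventually_sequentially by blast
    obtain k where k: "k \<ge> k0" "zs k = z"
      using inf unfolding infinite_nat_iff_unbounded_le by blast
    define yk where "yk i = (if i < k then y k i else 0)" for i
    define p where "p i = coef (z i) (Suc k)" for i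
    have z: "z \<in> direct_sum f" by (rule Y.direct_sum_finite(1)[OF z0])
    have p0: "p i = 0" if "i \<ge> L" for i
      using norm_coef_le[of "z i" "Suc k"] z0[OF that] by (simp add: p_def)
    have p: "p \<in> direct_sum f" by (rule Y.direct_sum_finite(1)[OF p0])
    have Np: "direct_sum_norm f p \<le> \<eta>"
      using Y.direct_sum_finite(2)[of L p, OF p0] k0[OF k(1)] by (simp add: p_def)
    let ?z = "\<lambda>i. \<epsilon> *\<^sub>R z i"
    have ez: "?z \<in> direct_sum f" "?N ?z \<le> \<epsilon> * ?N z"
      using Y.direct_sum_scaled[OF z \<epsilon>, of ?z] \<epsilon> by simp_all
    have err: "norm ((yk - z) i) \<le> norm (p i) + norm (?z i)" for i
    proof (cases "i < k")
      case True
      let ?c = "(\<rho> k * (1 - \<sigma> k)) *\<^sub>R b (Suc k) - \<sigma> k *\<^sub>R b 0"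
      have "(yk - z) i = coef (z i) 0 *\<^sub>C ?c - p i *\<^sub>C b (Suc k)"
        using True k by (simp add: yk_def y_def aim_def p_def)
      also have "norm \<dots> \<le> norm (coef (z i) 0 *\<^sub>C ?c) + norm (p i *\<^sub>C b (Suc k))"
        by (rule norm_triangle_ineq4)
      also have "\<dots> = cmod (coef (z i) 0) * norm ?c + norm (p i)"
        by (simp add: norm_scaleC)
      also have "cmod (coef (z i) 0) * norm ?c \<le> norm (z i) * \<epsilon>"
        by (intro mult_mono norm_coef_le contact) auto
      finally show ?thesis using \<epsilon> by (simp add: mult.commute)
    next
      case False
      then have "z i = 0" using k0[OF k(1)] by (intro z0) simp
      then show ?thesis using False by (simp add: yk_def)
    qed
    have ykz: "yk - z \<in> direct_sum f" "?N (yk - z) \<le> direct_sum_norm f p + ?N ?z"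
      by (rule Y.direct_sum_le_add[OF p ez(1) err])+
    define h where "h i = (T ^^ (s k + g k)) x i - yk i" for i
    have geo: "(\<lambda>i. (1 / 2 :: real) ^ k * (1 / 2) ^ i) sums ((1 / 2) ^ k * 2)"
      using sums_mult[OF geometric_sums[of "1 / 2 :: real"], of "(1 / 2) ^ k"] by simp
    have hle: "norm (h i) \<le> (1 / 2) ^ k * (1 / 2) ^ i" for i
      using orbit[of k i] by (simp add: h_def yk_def power_add)
    have sh: "summable (\<lambda>i. norm (h i))"
      by (rule summable_comparison_test'[OF sums_summable[OF geo], of 0]) (simp add: hle)
    have h: "h \<in> direct_sum f" by (rule Y.direct_sum_of_summable(1)[OF sh])
    have "?N h \<le> (\<Sum>i. norm (h i))" by (rule Y.direct_sum_of_summable(2)[OF sh])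
    also have "\<dots> \<le> (1 / 2) ^ k * 2"
      using suminf_le[OF hle sh sums_summable[OF geo]] sums_unique[OF geo] by simp
    also have "\<dots> \<le> \<eta>" using k0[OF k(1)] by (simp add: mult.commute)
    finally have Nh: "?N h \<le> \<eta>" .
    have zw': "z - w \<in> direct_sum f"
      by (rule Y.direct_sum_le_add(1)[OF z w]) (simp add: norm_triangle_ineq4)
    have "norm ((yk - w) i) \<le> norm ((yk - z) i) + norm ((z - w) i)" for i
      using norm_triangle_ineq[of "yk i - z i" "z i - w i"] by simp
    note ykw = Y.direct_sum_le_add[OF ykz(1) zw' this]
    have "norm (((T ^^ (s k + g k)) x - w) i) \<le> norm (h i) + norm ((yk - w) i)" for i
      using norm_triangle_ineq[of "h i" "yk i - w i"] by (simp add: h_def)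
    note total = Y.direct_sum_le_add(2)[OF h ykw(1) this]
    have "norm (z i) \<le> norm (w i) + norm ((z - w) i)" for i
      using norm_triangle_ineq[of "w i" "z i - w i"] by simp
    note Nz = Y.direct_sum_le_add(2)[OF w zw' this]
    have "?N z \<le> ?N w + \<eta>" using Nz zw by linarith
    then have "\<epsilon> * ?N z \<le> \<epsilon> * (?N w + \<eta>)"
      using \<epsilon> by (rule mult_left_mono)
    also have "\<dots> \<le> \<epsilon> * ?N w + \<eta>"
      using mult_right_mono[of \<epsilon> 1 \<eta>] \<delta> \<eta> by (simp add: distrib_left)
    finally have "?N ((T ^^ (s k + g k)) x - w) \<le> \<epsilon> * ?N w + 4 * \<eta>"
      using total ykw(2) ykz(2) ez(2) Np Nh zw by linarith
    also have "\<dots> = \<delta> * ?N w" by (simp add: \<eta>_def field_simps)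
    finally show ?thesis by blast
  qed
  with x show ?thesis
    unfolding delta_hypercyclic_on_def delta_hypercyclic_vector_on_def by blast
qed

end

theorem theorem1p2:
  fixes e :: "nat \<Rightarrow> 'a::complex_banach"
    and f :: "nat \<Rightarrow> 'b::complex_banach"
    and \<epsilon> :: real
  assumes "infinite_dimensional TYPE('a)"
    and "separable_space (euclidean :: 'a topology)"
    and "unconditional_basis 1 e"
    and "infinite_dimensional TYPE('b)"
    and "separable_space (euclidean :: 'b topology)"
    and "unconditional_basis 1 f"
    and "normalized f"
    and "backward_shift_continuous f"
    and "\<epsilon> \<in> {0<..<1}"
  shows "\<exists>T :: (nat \<Rightarrow> 'a) \<Rightarrow> (nat \<Rightarrow> 'a).
    bounded_operator_on (direct_sum f) (direct_sum_norm f) T \<and>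
    (\<forall>\<delta>\<in>{0<..<\<epsilon>}. \<not> delta_hypercyclic_on (direct_sum f) (direct_sum_norm f) \<delta> T) \<and>
    (\<forall>\<delta>\<in>{\<epsilon><..<1}. delta_hypercyclic_on (direct_sum f) (direct_sum_norm f) \<delta> T)"
proof -
  define e' where "e' = (\<lambda>n. (1 / norm (e n)) *\<^sub>R e n)"
  interpret X: normalized_unconditional_basis e'
    using normalize_unconditional_basis[OF assms(3)] unfolding e'_def by unfold_locales
  have f: "normalized_unconditional_basis f"
    using assms(6,7) by unfold_locales
  interpret Y: normalized_unconditional_basis f by (rule f)
  have eps: "0 < \<epsilon>" "\<epsilon> < 1" using assms(9) by auto
  have "\<exists>\<rho> \<sigma>. 0 \<le> \<rho> \<and> \<rho> \<le> \<epsilon> / (1 - \<epsilon>)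
      \<and> norm ((\<rho> * (1 - \<sigma>)) *\<^sub>R e' (Suc k) - \<sigma> *\<^sub>R e' 0) \<le> \<epsilon>
      \<and> (\<forall>t q. t \<ge> 0 \<longrightarrow> q \<ge> \<rho> * (1 - t) \<longrightarrow> q \<ge> 0 \<longrightarrow> \<epsilon> \<le> norm (t *\<^sub>R e' 0 + q *\<^sub>R e' (Suc k)))" for k
    by (rule X.tangent_line[OF eps nat.distinct(2), of k]) blast
  then obtain \<rho> \<sigma> where \<rho>: "\<And>k. 0 \<le> \<rho> k" "\<And>k. \<rho> k \<le> \<epsilon> / (1 - \<epsilon>)"
    and contact: "\<And>k. norm ((\<rho> k * (1 - \<sigma> k)) *\<^sub>R e' (Suc k) - \<sigma> k *\<^sub>R e' 0) \<le> \<epsilon>"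
    and tangent: "\<And>k t q. t \<ge> 0 \<Longrightarrow> q \<ge> \<rho> k * (1 - t) \<Longrightarrow> q \<ge> 0 \<Longrightarrow>
                    \<epsilon> \<le> norm (t *\<^sub>R e' 0 + q *\<^sub>R e' (Suc k))"
    by metis
  obtain zs :: "nat \<Rightarrow> nat \<Rightarrow> 'a" where dense: "\<And>w \<eta>. w \<in> direct_sum f \<Longrightarrow> \<eta> > 0 \<Longrightarrow>
       \<exists>z L. (\<forall>i\<ge>L. z i = 0) \<and> direct_sum_norm f (z - w) \<le> \<eta> \<and> infinite {k. zs k = z}"
    using Y.dense_targets[OF assms(2)] by blast
  define R where "R = 1 + \<epsilon> / (1 - \<epsilon>)"
  define y where "y k i = X.aim (\<rho> k) (\<sigma> k) (Suc k) (zs k i)" for k i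
  have "\<exists>g. \<forall>i<k. (4 + 3 * R) ^ (m + i) * 2 ^ (m + i) * norm (y k i) \<le> 2 ^ g" for k m
  proof -
    let ?a = "\<lambda>i. (4 + 3 * R) ^ (m + i) * 2 ^ (m + i) * norm (y k i)"
    have R: "R \<ge> 0" using eps by (simp add: R_def)
    obtain g where "(\<Sum>i<k. ?a i) < 2 ^ g"
      using real_arch_pow[of 2 "\<Sum>i<k. ?a i"] by auto
    moreover have "?a i \<le> (\<Sum>i<k. ?a i)" if "i < k" for i
      by (rule member_le_sum) (use that R in auto)
    ultimately show ?thesis by (intro exI[of _ g]) force
  qed
  then obtain G where G: "\<And>k m i. i < k \<Longrightarrow> (4 + 3 * R) ^ (m + i) * 2 ^ (m + i) * norm (y k i) \<le> 2 ^ G k m"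
    by metis
  \<comment> \<open>The height required in a block depends on where the block starts, so the borders are found
    recursively.\<close>
  define s where "s = rec_nat 0 (\<lambda>k m. m + 2 * G k m + k + 1)"
  have s: "s 0 = 0" "\<And>k. s (Suc k) = s k + 2 * G k (s k) + k + 1"
    by (simp_all add: s_def)
  interpret tent_weighted_shift e' \<rho> R s
    by unfold_locales (use \<rho> s in \<open>simp_all add: R_def strict_mono_Suc_iff\<close>)
  show ?thesis
  proof (intro exI[of _ T] conjI ballI)
    show "bounded_operator_on (direct_sum f) (direct_sum_norm f) T"
      by (rule bounded_operator_T[OF f assms(8)])
    show "\<not> delta_hypercyclic_on (direct_sum f) (direct_sum_norm f) \<delta> T" if "\<delta> \<in> {0<..<\<epsilon>}" for \<delta>
      by (rule not_delta_hypercyclic[OF f assms(8) tangent]) (use that in auto)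
    show "delta_hypercyclic_on (direct_sum f) (direct_sum_norm f) \<delta> T" if "\<delta> \<in> {\<epsilon><..<1}" for \<delta>
      by (rule delta_hypercyclic[OF f contact dense s(2) G[unfolded y_def]])
         (use that eps in auto)
  qed
qed

end
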